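(* (In $\mathsf{ZFC}$.) Every locally countable partial order of size continuum and height two embeds into the Turing degrees.
   Context: A partial order $(P,\leq_P)$ is locally countable if for every $x\in P$ the set $\{y\in P \mid y<_P x\}$ is countable. For a natural number $n>0$, a partial order has height $n$ if its longest chain has length exactly $n$. The Turing degrees are partially ordered by Turing reducibility $\leq_T$; an embedding of $P$ into the Turing degrees is an injective map $F$ from $P$ to the Turing degrees with $x\leq_P y \iff F(x)\leq_T F(y)$ for all $x,y\in P$. *)

theory Defs
  imports Complex_Main "HOL-Library.Countable_Set" "HOL-Library.Equipollence"
begin

datatype recf =
    Zero
  | Succ
  | Proj nat
  | Oracle
  | Cn recf "recf list"
  | Pr recf recf
  | Mn recf

inductive oeval :: "nat set \<Rightarrow> recf \<Rightarrow> nat list \<Rightarrow> nat \<Rightarrow> bool" for A :: "nat set" where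
  zero: "oeval A Zero xs 0"
| succ: "oeval A Succ (x # xs) (Suc x)"
| proj: "i < length xs \<Longrightarrow> oeval A (Proj i) xs (xs ! i)"
| orc: "oeval A Oracle (x # xs) (if x \<in> A then 1 else 0)"
| cn: "list_all2 (\<lambda>g y. oeval A g xs y) gs ys \<Longrightarrow> oeval A f ys z \<Longrightarrow> oeval A (Cn f gs) xs z"
| pr0: "oeval A f xs y \<Longrightarrow> oeval A (Pr f g) (0 # xs) y"
| prS: "oeval A (Pr f g) (n # xs) r \<Longrightarrow> oeval A g (n # r # xs) y \<Longrightarrow> oeval A (Pr f g) (Suc n # xs) y"
| mn: "oeval A f (n # xs) 0 \<Longrightarrow> (\<forall>m<n. \<exists>y. oeval A f (m # xs) y \<and> y > 0) \<Longrightarrow> oeval A (Mn f) xs n"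

definition turing_reducible :: "nat set \<Rightarrow> nat set \<Rightarrow> bool" (infix "\<le>\<^sub>T" 50) where
  "A \<le>\<^sub>T B \<longleftrightarrow> (\<exists>f. \<forall>x. oeval B f [x] (if x \<in> A then 1 else 0))"

definition turing_equiv :: "nat set rel" where
  "turing_equiv = {(A, B). A \<le>\<^sub>T B \<and> B \<le>\<^sub>T A}"

definition turing_degrees :: "nat set set set" where
  "turing_degrees = UNIV // turing_equiv"

definition degree_le :: "nat set set \<Rightarrow> nat set set \<Rightarrow> bool" where
  "degree_le D E \<longleftrightarrow> (\<exists>A\<in>D. \<exists>B\<in>E. A \<le>\<^sub>T B)"

definition locally_countable :: "'a set \<Rightarrow> 'a rel \<Rightarrow> bool" where
  "locally_countable P r \<longleftrightarrow> (\<forall>x\<in>P. countable {y \<in> P. (y, x) \<in> r \<and> y \<noteq> x})"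

definition is_chain :: "'a set \<Rightarrow> 'a rel \<Rightarrow> 'a set \<Rightarrow> bool" where
  "is_chain P r C \<longleftrightarrow> C \<subseteq> P \<and> (\<forall>a\<in>C. \<forall>b\<in>C. (a, b) \<in> r \<or> (b, a) \<in> r)"

definition has_height :: "'a set \<Rightarrow> 'a rel \<Rightarrow> nat \<Rightarrow> bool" where
  "has_height P r n \<longleftrightarrow>
     (\<forall>C. is_chain P r C \<longrightarrow> finite C \<and> card C \<le> n) \<and>
     (\<exists>C. is_chain P r C \<and> finite C \<and> card C = n)"

end

theory Submission
  imports Defs
begin

text \<open>The minimal elements are sent to members of a perfect family of mutually generic sets, which
  are independent: none is computable from finitely many others. For a countable sequence of sets
  there is a perfect family of upper bounds any two of which have only those lower bounds in common
  that are computable from finitely many members of the sequence (a perfect version of the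
  Spector exact pair theorem). Hence a set outside this ideal is computed by at most one upper bound
  of the family, and every set computes only countably many members of either family.

  The images are chosen by transfinite recursion along a well-order of length at most the continuum.
  At each stage each of the fewer than continuum many earlier elements excludes only countably many
  candidates, so some candidate is incomparable with everything it has to be incomparable with.\<close>

section \<open>Oracle computations\<close>

inductive_cases oeval_ZeroE: "oeval A Zero xs y"
inductive_cases oeval_SuccE: "oeval A Succ xs y"
inductive_cases oeval_ProjE: "oeval A (Proj i) xs y"
inductive_cases oeval_OracleE: "oeval A Oracle xs y"
inductive_cases oeval_CnE: "oeval A (Cn f gs) xs y"
inductive_cases oeval_Pr0E: "oeval A (Pr f g) (0 # xs) y"
inductive_cases oeval_PrSE: "oeval A (Pr f g) (Suc n # xs) y"
inductive_cases oeval_MnE: "oeval A (Mn f) xs y"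

abbreviation chi :: "nat set \<Rightarrow> nat \<Rightarrow> nat" where
  "chi A x \<equiv> (if x \<in> A then 1 else 0)"

lemma oeval_deterministic: "oeval A f xs y \<Longrightarrow> oeval A f xs y' \<Longrightarrow> y' = y"
proof (induction arbitrary: y' rule: oeval.induct)
  case (cn xs gs ys f z)
  from cn.prems obtain ys' where
    ys': "list_all2 (\<lambda>g y. oeval A g xs y) gs ys'" "oeval A f ys' y'"
    by (rule oeval_CnE) blast
  have "ys' = ys"
    using cn.IH(1) ys'(1) by (auto simp: list_all2_conv_all_nth intro!: nth_equalityI)
  then show ?case using cn.IH(2) ys'(2) by simp
next
  case (prS f g n xs r y)
  from prS.prems obtain r' where "oeval A (Pr f g) (n # xs) r'" "oeval A g (n # r' # xs) y'"
    by (rule oeval_PrSE) blast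
  then show ?case using prS.IH by blast
next
  case (mn f n xs)
  from mn.prems have z: "oeval A f (y' # xs) 0"
    and p: "\<forall>m<y'. \<exists>y. oeval A f (m # xs) y \<and> y > 0"
    by (auto elim: oeval_MnE)
  have "\<not> n < y'" using p mn.IH(1) by fastforce
  moreover have "\<not> y' < n" using z mn.IH(2) by fastforce
  ultimately show ?case by simp
next
  case (pr0 f xs y g)
  from pr0.prems have "oeval A f xs y'" by (rule oeval_Pr0E)
  then show ?case by (rule pr0.IH)
qed (erule oeval_ZeroE oeval_SuccE oeval_ProjE oeval_OracleE, simp)+

text \<open>The neighbourhood filter of \<open>A\<close> in Cantor space, so that the use principle becomes
  continuity of oracle computations.\<close>

definition near :: "nat set \<Rightarrow> nat set filter" where
  "near A = (INF m. principal {B. \<forall>x<m. x \<in> B \<longleftrightarrow> x \<in> A})"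

lemma eventually_near:
  "eventually Q (near A) \<longleftrightarrow> (\<exists>m. \<forall>B. (\<forall>x<m. x \<in> B \<longleftrightarrow> x \<in> A) \<longrightarrow> Q B)"
proof -
  have "eventually Q (near A) \<longleftrightarrow>
      (\<exists>m\<in>UNIV. eventually Q (principal {B. \<forall>x<m. x \<in> B \<longleftrightarrow> x \<in> A}))"
    unfolding near_def
  proof (rule eventually_INF_base)
    fix a b :: nat
    show "\<exists>m\<in>UNIV. principal {B. \<forall>x<m. x \<in> B \<longleftrightarrow> x \<in> A}
        \<le> inf (principal {B. \<forall>x<a. x \<in> B \<longleftrightarrow> x \<in> A}) (principal {B. \<forall>x<b. x \<in> B \<longleftrightarrow> x \<in> A})"
      by (rule bexI[of _ "max a b"]) auto
  qed simp
  then show ?thesis by (simp add: eventually_principal)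
qed

text \<open>A halting computation is built from finitely many subcomputations, and finitely many
  neighbourhoods of \<open>A\<close> have a common refinement. Only an oracle query restricts
  \<open>B\<close> by itself.\<close>

lemma oeval_continuous: "oeval A f xs y \<Longrightarrow> eventually (\<lambda>B. oeval B f xs y) (near A)"
proof (induction rule: oeval.induct)
  case (orc x xs)
  have "eventually (\<lambda>B. x \<in> B \<longleftrightarrow> x \<in> A) (near A)"
    unfolding eventually_near by blast
  then show ?case
    by (rule eventually_mono) (use oeval.orc in metis)
next
  case (cn xs gs ys f z)
  have "eventually (\<lambda>B. \<forall>i\<in>{..<length gs}. oeval B (gs ! i) xs (ys ! i)) (near A)"
    using cn.IH(1) by (intro eventually_ball_finite) (auto simp: list_all2_conv_all_nth)
  with cn.IH(2) have "eventually (\<lambda>B. oeval B f ys z \<and>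
      (\<forall>i\<in>{..<length gs}. oeval B (gs ! i) xs (ys ! i))) (near A)"
    by (rule eventually_conj)
  then show ?case
    by (rule eventually_mono)
      (use cn.IH(1) in \<open>auto simp: list_all2_conv_all_nth intro!: oeval.cn[of _ xs gs ys]\<close>)
next
  case (pr0 f xs y g)
  from pr0.IH show ?case by (rule eventually_mono) (rule oeval.pr0)
next
  case (prS f g n xs r y)
  from prS.IH show ?case by (rule eventually_elim2) (rule oeval.prS)
next
  case (mn f n xs)
  have "eventually (\<lambda>B. \<forall>m\<in>{..<n}. \<exists>y. oeval B f (m # xs) y \<and> y > 0) (near A)"
  proof (intro eventually_ball_finite ballI finite_lessThan)
    fix m assume "m \<in> {..<n}"
    then obtain y where "eventually (\<lambda>B. oeval B f (m # xs) y) (near A)" "y > 0"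
      using mn.IH(2) by blast
    then show "eventually (\<lambda>B. \<exists>y. oeval B f (m # xs) y \<and> y > 0) (near A)"
      by (blast intro: eventually_mono)
  qed
  with mn.IH(1) show ?case by (rule eventually_elim2) (simp add: oeval.mn)
qed (simp_all add: always_eventually oeval.zero oeval.succ oeval.proj)

lemma oeval_use:
  assumes "oeval A f xs y"
  obtains m where "\<And>B. \<forall>x<m. x \<in> B \<longleftrightarrow> x \<in> A \<Longrightarrow> oeval B f xs y"
  using oeval_continuous[OF assms] unfolding eventually_near by blast

lemma oeval_Cn1: "oeval A g xs y \<Longrightarrow> oeval A f [y] z \<Longrightarrow> oeval A (Cn f [g]) xs z"
  by (rule oeval.cn[of _ _ _ "[y]"]) auto

lemma oeval_Proj0: "oeval A (Proj 0) (x # xs) x"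
  using oeval.proj[of 0 "x # xs"] by simp

text \<open>Composition of reductions: each query is answered by running \<open>h\<close>. A query
  reads only the head of its argument list, while \<open>h\<close> is trusted on one-element lists;
  hence the \<open>Proj 0\<close>.\<close>

fun oracle_subst :: "recf \<Rightarrow> recf \<Rightarrow> recf" where
  "oracle_subst h Oracle = Cn h [Proj 0]"
| "oracle_subst h (Cn f gs) = Cn (oracle_subst h f) (map (oracle_subst h) gs)"
| "oracle_subst h (Pr f g) = Pr (oracle_subst h f) (oracle_subst h g)"
| "oracle_subst h (Mn f) = Mn (oracle_subst h f)"
| "oracle_subst h f = f"

lemma oeval_oracle_subst:
  assumes "\<And>x. oeval B h [x] (chi A x)"
  shows "oeval A f xs y \<Longrightarrow> oeval B (oracle_subst h f) xs y"
proof (induction rule: oeval.induct)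
  case (orc x xs)
  show ?case using oeval_Cn1[OF oeval_Proj0 assms[of x]] by simp
next
  case (cn xs gs ys f z)
  then show ?case by (auto intro!: oeval.cn[of _ _ _ ys] simp: list_all2_conv_all_nth)
next
  case (mn f n xs)
  then show ?case by (auto intro!: oeval.mn)
next
  case (prS f g n xs r y)
  from prS.IH show ?case unfolding oracle_subst.simps by (rule oeval.prS)
qed (simp_all add: oeval.zero oeval.succ oeval.proj oeval.pr0)

section \<open>The preorder of Turing reducibility\<close>

lemma turing_reducible_refl: "A \<le>\<^sub>T A"
  unfolding turing_reducible_def by (rule exI[of _ Oracle]) (blast intro: oeval.orc)

lemma turing_reducible_trans:
  assumes "A \<le>\<^sub>T B" "B \<le>\<^sub>T C" shows "A \<le>\<^sub>T C"
  using assms oeval_oracle_subst unfolding turing_reducible_def by metis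

instance recf :: countable
  by countable_datatype

text \<open>For a fixed oracle a program determines at most one set, so choosing a program for each
  set injects the cone into the countable type \<open>recf\<close>.\<close>

lemma countable_lower_cone: "countable {A. A \<le>\<^sub>T B}"
proof -
  define dom where "dom A = (SOME f. \<forall>x. oeval B f [x] (chi A x))" for A
  have dom: "oeval B (dom A) [x] (chi A x)" if "A \<le>\<^sub>T B" for A x
    using someI_ex[OF that[unfolded turing_reducible_def]] unfolding dom_def by blast
  have "inj_on dom {A. A \<le>\<^sub>T B}"
  proof (rule inj_onI, clarsimp)
    fix A A' assume "A \<le>\<^sub>T B" "A' \<le>\<^sub>T B" "dom A = dom A'"
    then have "chi A x = chi A' x" for x
      using dom[of A x] dom[of A' x] oeval_deterministic by metis
    then show "A = A'" by (auto split: if_splits) (metis zero_neq_one)+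
  qed
  then show ?thesis by (rule countableI')
qed

lemma turing_reducible_tail: "{x. Suc x \<in> A} \<le>\<^sub>T A"
proof -
  have "oeval A (Cn Oracle [Succ]) [x] (chi {x. Suc x \<in> A} x)" for x
    using oeval.orc[of A "Suc x" "[]"] by (auto intro!: oeval_Cn1[OF oeval.succ])
  then show ?thesis unfolding turing_reducible_def by blast
qed

lemma turing_reducible_from_tail:
  assumes "{x. Suc x \<in> A} \<le>\<^sub>T B" shows "A \<le>\<^sub>T B"
proof -
  obtain h where h: "\<And>x. oeval B h [x] (chi {x. Suc x \<in> A} x)"
    using assms unfolding turing_reducible_def by blast
  obtain k where k: "oeval B k [] (chi A 0)"
  proof (cases "0 \<in> A")
    case True
    then show ?thesis
      using that[of "Cn Succ [Zero]"] oeval_Cn1[OF oeval.zero oeval.succ, of B "[]"] by simp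
  qed (use that[of Zero] oeval.zero in auto)
  \<comment> \<open>\<open>Pr\<close> acts as a case distinction: argument 0 gets the constant
    \<open>k\<close>, and at \<open>Suc x\<close> the recursive value is ignored and
    \<open>h\<close> is applied to \<open>x\<close>.\<close>
  define q where "q = Pr k (Cn h [Proj 0])"
  have "oeval B q [x] (chi A x)" for x
  proof (induction x)
    case 0
    then show ?case unfolding q_def using k by (rule oeval.pr0)
  next
    case (Suc x)
    then show ?case
      using h[of x] unfolding q_def
      by (auto intro!: oeval.prS[of _ _ _ _ _ "chi A x"] oeval_Cn1[OF oeval_Proj0])
  qed
  then show ?thesis unfolding turing_reducible_def by blast
qed

text \<open>Differing bits are removed one at a time: both sets are replaced by their tails, and the
  first bit of \<open>A\<close> is restored as a constant of the program.\<close>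

lemma turing_reducible_finite_change:
  "(\<And>x. x \<ge> N \<Longrightarrow> x \<in> A \<longleftrightarrow> x \<in> B) \<Longrightarrow> A \<le>\<^sub>T B"
proof (induction N arbitrary: A B)
  case 0
  then have "A = B" by auto
  then show ?case by (simp add: turing_reducible_refl)
next
  case (Suc N)
  have "{x. Suc x \<in> A} \<le>\<^sub>T {x. Suc x \<in> B}"
    by (rule Suc.IH) (use Suc.prems in auto)
  then show ?case
    using turing_reducible_from_tail turing_reducible_tail turing_reducible_trans by metis
qed

text \<open>This is 2^i * (2 * k + 1), which splits the positive numbers into infinitely many
  columns. For each fixed \<open>i\<close> it is computed by iterated doubling.\<close>

fun cell :: "nat \<Rightarrow> nat \<Rightarrow> nat" where
  "cell 0 k = Suc (2 * k)"
| "cell (Suc i) k = 2 * cell i k"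

lemma cell_inject [simp]: "cell i k = cell j l \<longleftrightarrow> i = j \<and> k = l"
proof (induction i arbitrary: j)
  case 0
  show ?case by (cases j) (auto, presburger+)
next
  case (Suc i)
  show ?case by (cases j) (auto simp: Suc.IH, presburger+)
qed

lemma le_cell: "k \<le> cell i k"
  by (induction i) auto

definition double :: recf where
  "double = Pr Zero (Cn Succ [Cn Succ [Proj 1]])"

lemma oeval_double: "oeval A double [n] (2 * n)"
proof (induction n)
  case 0
  show ?case unfolding double_def by (auto intro: oeval.pr0 oeval.zero)
next
  case (Suc n)
  have "oeval A (Proj 1) [n, 2 * n] (2 * n)"
    using oeval.proj[of 1 "[n, 2 * n]"] by simp
  then have "oeval A (Cn Succ [Cn Succ [Proj 1]]) [n, 2 * n] (2 * Suc n)"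
    using oeval_Cn1[OF oeval_Cn1[OF _ oeval.succ] oeval.succ] by fastforce
  with Suc show ?case unfolding double_def by (rule oeval.prS)
qed

fun cell_prog :: "nat \<Rightarrow> recf" where
  "cell_prog 0 = Cn Succ [double]"
| "cell_prog (Suc i) = Cn double [cell_prog i]"

lemma oeval_cell_prog: "oeval A (cell_prog i) [k] (cell i k)"
  by (induction i) (auto intro: oeval_Cn1 oeval_double oeval.succ simp del: mult_Suc_right)

lemma oeval_column: "oeval A (Cn Oracle [cell_prog i]) [k] (chi {k. cell i k \<in> A} k)"
  using oeval_Cn1[OF oeval_cell_prog oeval.orc] by auto

lemma turing_reducible_column: "{k. cell i k \<in> A} \<le>\<^sub>T A"
  unfolding turing_reducible_def using oeval_column by blast

section \<open>Fusion of Cantor conditions\<close>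

text \<open>\<open>E\<close> extends the forcing condition with finite part \<open>X\<close> below
  \<open>N\<close>; from \<open>N\<close> on the positions in \<open>M\<close> are frozen to
  \<open>C\<close> and all others are free. With \<open>M = {}\<close> this is a Cohen
  condition.\<close>

definition ext :: "nat \<Rightarrow> nat set \<Rightarrow> nat set \<Rightarrow> nat set \<Rightarrow> nat set \<Rightarrow> bool" where
  "ext N X M C E \<longleftrightarrow>
    (\<forall>a<N. a \<in> E \<longleftrightarrow> a \<in> X) \<and> (\<forall>a\<ge>N. a \<in> M \<longrightarrow> (a \<in> E \<longleftrightarrow> a \<in> C))"

lemma ext_trans:
  assumes "ext N X M C X'" "N \<le> N'" "M \<subseteq> M'" "ext N' X' M' C E"
  shows "ext N X M C E"
  unfolding ext_def
proof (intro conjI allI impI)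
  fix a assume "a < N"
  then show "a \<in> E \<longleftrightarrow> a \<in> X" using assms by (simp add: ext_def)
next
  fix a assume "N \<le> a" "a \<in> M"
  then show "a \<in> E \<longleftrightarrow> a \<in> C"
    using assms by (cases "a < N'") (auto simp: ext_def)
qed

lemma ext_mono: "ext N X M C E \<Longrightarrow> ext N' E M C X' \<Longrightarrow> N \<le> N' \<Longrightarrow> ext N X M C X'"
  by (rule ext_trans) auto

text \<open>\<open>Q\<close> is open and dense for families of sets indexed by \<open>S\<close>, each member growing under its
  own condition.\<close>

definition densely ::
  "nat set \<Rightarrow> nat set \<Rightarrow> 's set \<Rightarrow> (('s \<Rightarrow> nat set) \<Rightarrow> bool) \<Rightarrow> bool" where
  "densely M C S Q \<longleftrightarrow> (\<forall>N X. \<exists>N' X'. N \<le> N' \<and> (\<forall>s\<in>S. ext N (X s) M C (X' s)) \<and>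
     (\<forall>Y. (\<forall>s\<in>S. ext N' (X' s) M C (Y s)) \<longrightarrow> Q Y))"

lemma denselyE:
  assumes "densely M C S Q"
  obtains N' X' where "N \<le> N'" and "\<And>s. s \<in> S \<Longrightarrow> ext N (X s) M C (X' s)"
    and "\<And>Y. (\<And>s. s \<in> S \<Longrightarrow> ext N' (X' s) M C (Y s)) \<Longrightarrow> Q Y"
proof -
  obtain N' X' where "N \<le> N'" "\<forall>s\<in>S. ext N (X s) M C (X' s)"
      "\<forall>Y. (\<forall>s\<in>S. ext N' (X' s) M C (Y s)) \<longrightarrow> Q Y"
    using assms[unfolded densely_def, rule_format, of N X] by (elim exE conjE)
  then show ?thesis by (intro that[of N' X']) simp_all
qed

lemma ext_exists: "\<exists>E. ext N X M C E"
  by (rule exI[of _ "{a. if a < N then a \<in> X else a \<in> C}"]) (simp add: ext_def)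

lemma densely_True: "densely M C S (\<lambda>Y. True)"
  unfolding densely_def
proof (intro allI)
  fix N :: nat and X :: "'a \<Rightarrow> nat set"
  have "\<forall>s. \<exists>E. ext N (X s) M C E" using ext_exists by blast
  then obtain X' where "\<forall>s. ext N (X s) M C (X' s)" by (rule choice[THEN exE])
  then show "\<exists>N' X'. N \<le> N' \<and> (\<forall>s\<in>S. ext N (X s) M C (X' s)) \<and>
      (\<forall>Y. (\<forall>s\<in>S. ext N' (X' s) M C (Y s)) \<longrightarrow> True)" by blast
qed

lemma densely_conj:
  assumes "densely M C S Q" "densely M C S R"
  shows "densely M C S (\<lambda>Y. Q Y \<and> R Y)"
  unfolding densely_def
proof (intro allI)
  fix N X
  obtain N1 X1 where 1: "N \<le> N1" "\<And>s. s \<in> S \<Longrightarrow> ext N (X s) M C (X1 s)"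
      "\<And>Y. (\<And>s. s \<in> S \<Longrightarrow> ext N1 (X1 s) M C (Y s)) \<Longrightarrow> Q Y"
    using denselyE[OF assms(1), of N X] by metis
  obtain N2 X2 where 2: "N1 \<le> N2" "\<And>s. s \<in> S \<Longrightarrow> ext N1 (X1 s) M C (X2 s)"
      "\<And>Y. (\<And>s. s \<in> S \<Longrightarrow> ext N2 (X2 s) M C (Y s)) \<Longrightarrow> R Y"
    using denselyE[OF assms(2), of N1 X1] by metis
  have "ext N (X s) M C (X2 s)" if "s \<in> S" for s
    using ext_mono[OF 1(2) 2(2) 1(1)] that by simp
  moreover have "Q Y" if "\<forall>s\<in>S. ext N2 (X2 s) M C (Y s)" for Y
    using 1(3) ext_mono[OF 2(2) _ 2(1)] that by simp
  ultimately show "\<exists>N' X'. N \<le> N' \<and> (\<forall>s\<in>S. ext N (X s) M C (X' s)) \<and>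
      (\<forall>Y. (\<forall>s\<in>S. ext N' (X' s) M C (Y s)) \<longrightarrow> Q Y \<and> R Y)"
    using 1(1) 2(1,3) by (intro exI[of _ N2] exI[of _ X2]) simp
qed

lemma densely_ball:
  assumes "finite F" "\<And>q. q \<in> F \<Longrightarrow> densely M C S (Q q)"
  shows "densely M C S (\<lambda>Y. \<forall>q\<in>F. Q q Y)"
  using assms
proof (induction F rule: finite_induct)
  case empty
  show ?case using densely_True by simp
next
  case (insert q F)
  then show ?case using densely_conj[of M C S "Q q" "\<lambda>Y. \<forall>q\<in>F. Q q Y"] by simp
qed

section \<open>Perfect trees of conditions\<close>

abbreviation restr :: "nat \<Rightarrow> (nat \<Rightarrow> bool) \<Rightarrow> bool list" where
  "restr l z \<equiv> map z [0..<l]"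

abbreviation strings :: "nat \<Rightarrow> bool list set" where
  "strings l \<equiv> {s. length s = l}"

lemma finite_strings: "finite (strings l)"
  using finite_lists_length_eq[of "UNIV :: bool set" l] by simp

lemma inj_on_restr:
  assumes "finite Z" obtains l0 where "\<And>l. l \<ge> l0 \<Longrightarrow> inj_on (restr l) Z"
proof -
  have "eventually (\<lambda>l. \<forall>v\<in>Z \<times> Z. fst v \<noteq> snd v \<longrightarrow> restr l (fst v) \<noteq> restr l (snd v)) sequentially"
  proof (intro eventually_ball_finite ballI)
    fix v assume "v \<in> Z \<times> Z"
    show "eventually (\<lambda>l. fst v \<noteq> snd v \<longrightarrow> restr l (fst v) \<noteq> restr l (snd v)) sequentially"
    proof (cases "fst v = snd v")
      case False
      then obtain i where "fst v i \<noteq> snd v i" by blast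
      then have "restr l (fst v) \<noteq> restr l (snd v)" if "l \<ge> Suc i" for l
        using that by auto
      then show ?thesis unfolding eventually_sequentially by blast
    qed simp
  qed (use assms in simp)
  then show ?thesis
    using that unfolding eventually_sequentially inj_on_def by (metis SigmaI fst_conv snd_conv)
qed

text \<open>A binary tree of conditions is grown level by level: those at level \<open>l\<close> are
  extended to meet \<open>Q l\<close>, then each is copied to both children; \<open>B z\<close> is
  the limit along the branch \<open>z\<close>. Finitely many branches run through distinct nodes
  from some level on, so \<open>Q l\<close> applies to them simultaneously.\<close>

lemma fusion:
  fixes M :: "nat \<Rightarrow> nat set" and Q :: "nat \<Rightarrow> (bool list \<Rightarrow> nat set) \<Rightarrow> bool"
  assumes mono: "\<And>l. M l \<subseteq> M (Suc l)"
    and dense: "\<And>l. densely (M l) C (strings l) (Q l)"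
  shows "\<exists>B :: (nat \<Rightarrow> bool) \<Rightarrow> nat set. (\<forall>l z. \<exists>N X. ext N X (M l) C (B z)) \<and>
    (\<forall>Z. finite Z \<longrightarrow>
      (\<exists>l0. \<forall>l\<ge>l0. inj_on (restr l) Z \<and> (\<exists>Y. Q l Y \<and> (\<forall>z\<in>Z. Y (restr l z) = B z))))"
proof -
  \<comment> \<open>A stage is a common length together with one condition per string. The last
    clause lets \<open>Y s\<close> extend either child of \<open>s\<close>, since a branch through
    \<open>s\<close> may follow either.\<close>
  define step where "step l p p' \<longleftrightarrow> fst p < fst p' \<and>
      (\<forall>s\<in>strings (Suc l). ext (fst p) (snd p (butlast s)) (M l) C (snd p' s)) \<and>
      (\<forall>Y. (\<forall>s\<in>strings l. \<exists>b. ext (fst p') (snd p' (s @ [b])) (M l) C (Y s)) \<longrightarrow> Q l Y)"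
    for l and p p' :: "nat \<times> (bool list \<Rightarrow> nat set)"
  have "\<exists>p'. step l p p'" for l p
  proof -
    obtain N X where p: "p = (N, X)" by fastforce
    obtain N' X' where 1: "N \<le> N'" "\<And>s. s \<in> strings l \<Longrightarrow> ext N (X s) (M l) C (X' s)"
      "\<And>Y. (\<And>s. s \<in> strings l \<Longrightarrow> ext N' (X' s) (M l) C (Y s)) \<Longrightarrow> Q l Y"
      using denselyE[OF dense[of l], of N X] by metis
    have "ext N' (X' s) (M l) C E" if "ext (Suc N') (X' s) (M l) C E" "s \<in> strings l" for s E
    proof -
      have "ext N' (X' s) (M l) C (X' s)" using 1(1) 1(2)[OF that(2)] by (auto simp: ext_def)
      with that(1) show ?thesis using ext_mono by (metis le_SucI order_refl)
    qed
    \<comment> \<open>Both children inherit the condition of their parent; \<open>Suc\<close> makes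
      the lengths grow strictly.\<close>
    then have "step l p (Suc N', \<lambda>s. X' (butlast s))"
      using 1 unfolding step_def p by auto
    then show ?thesis ..
  qed
  then obtain p where p: "\<And>l. step l (p l) (p (Suc l))"
    using dependent_nat_choice[of "\<lambda>_ _. True" step] by auto
  define N where "N l = fst (p l)" for l
  define X where "X l z = snd (p l) (restr l z)" for l z
  have N: "N l < N (Suc l)" for l using p[of l] by (simp add: step_def N_def)
  have N_ge: "l \<le> N l" for l
    by (induction l) (use N le_less_trans Suc_leI in blast)+
  have N_mono: "N l \<le> N l'" if "l \<le> l'" for l l'
    using that by (rule lift_Suc_mono_le[rotated]) (use N less_imp_le in blast)
  have M_mono: "M l \<subseteq> M l'" if "l \<le> l'" for l l'
    using that by (rule lift_Suc_mono_le[rotated]) (use mono in blast)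
  have X_Suc: "ext (N l) (X l z) (M l) C (X (Suc l) z)" for l z
  proof -
    have "restr (Suc l) z \<in> strings (Suc l)" by simp
    then have "ext (N l) (snd (p l) (butlast (restr (Suc l) z))) (M l) C (X (Suc l) z)"
      using p[of l] unfolding step_def N_def X_def by blast
    then show ?thesis by (simp add: X_def butlast_append)
  qed
  have X_ext: "ext (N l) (X l z) (M l) C (X l' z)" if "l < l'" for l l' z
    using that
  proof (induction rule: less_Suc_induct)
    case (2 i j k)
    then show ?case using ext_trans N_mono M_mono less_imp_le by metis
  qed (rule X_Suc)
  \<comment> \<open>Bit \<open>a\<close> is already settled at level \<open>Suc a\<close>, since
    \<open>a < Suc a \<le> N (Suc a)\<close>.\<close>
  define B where "B z = {a. a \<in> X (Suc a) z}" for z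
  have B: "ext (N l) (X l z) (M l) C (B z)" for l z
  proof -
    have same: "a \<in> B z \<longleftrightarrow> a \<in> X l' z" if "Suc a < l'" for a l'
      using X_ext[OF that, of z] N_ge[of "Suc a"] by (simp add: B_def ext_def)
    have "(a < N l \<longrightarrow> (a \<in> B z \<longleftrightarrow> a \<in> X l z)) \<and> (N l \<le> a \<longrightarrow> a \<in> M l \<longrightarrow> (a \<in> B z \<longleftrightarrow> a \<in> C))"
      for a
      using X_ext[of l "Suc (Suc (l + a))" z] same[of a "Suc (Suc (l + a))"] by (simp add: ext_def)
    then show ?thesis unfolding ext_def by blast
  qed
  show ?thesis
  proof (intro exI[of _ B] conjI allI impI)
    show "\<exists>N X. ext N X (M l) C (B z)" for l z using B by blast
  next
    fix Z :: "(nat \<Rightarrow> bool) set" assume "finite Z"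
    then obtain l0 where l0: "\<And>l. l \<ge> l0 \<Longrightarrow> inj_on (restr l) Z" by (rule inj_on_restr) blast
    have "\<exists>Y. Q l Y \<and> (\<forall>z\<in>Z. Y (restr l z) = B z)" if "l \<ge> l0" for l
    proof -
      \<comment> \<open>\<open>Q l\<close> speaks of a whole level, so every node gets a branch: one
        from \<open>Z\<close> if possible, otherwise any branch through it (\<open>s ! i\<close> is
        arbitrary beyond the length of \<open>s\<close>).\<close>
      define br where "br s = (if s \<in> restr l ` Z then inv_into Z (restr l) s else (\<lambda>i. s ! i))" for s
      have br: "restr l (br s) = s" if "s \<in> strings l" for s
        using f_inv_into_f[of s "restr l" Z] that by (auto simp: br_def map_nth)
      have "\<exists>b. ext (N (Suc l)) (snd (p (Suc l)) (s @ [b])) (M l) C (B (br s))"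
        if "s \<in> strings l" for s
      proof -
        have "X (Suc l) (br s) = snd (p (Suc l)) (s @ [br s l])"
          using br[OF that] by (simp add: X_def)
        with B[of "Suc l" "br s"] mono[of l] show ?thesis
          by (auto simp: ext_def intro!: exI[of _ "br s l"])
      qed
      then have "Q l (\<lambda>s. B (br s))"
        using p[of l] unfolding step_def N_def by simp
      moreover have "br (restr l z) = z" if "z \<in> Z" for z
        unfolding br_def
        using inv_into_f_f[OF l0[OF \<open>l \<ge> l0\<close>] that] imageI[OF that, of "restr l"]
        by (simp only: if_True)
      ultimately show ?thesis by (intro exI[of _ "\<lambda>s. B (br s)"]) simp
    qed
    with l0 show "\<exists>l0. \<forall>l\<ge>l0. inj_on (restr l) Z \<and> (\<exists>Y. Q l Y \<and> (\<forall>z\<in>Z. Y (restr l z) = B z))"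
      by blast
  qed
qed

section \<open>Independent families and exact upper bounds\<close>

definition cols :: "nat \<Rightarrow> nat set" where
  "cols n = {cell i k |i k. i < n}"

text \<open>The infinite join of the sequence \<open>c\<close>.\<close>

definition columns :: "(nat \<Rightarrow> nat set) \<Rightarrow> nat set" where
  "columns c = {cell i k |i k. k \<in> c i}"

lemma cell_in_cols [simp]: "cell i k \<in> cols n \<longleftrightarrow> i < n"
  by (auto simp: cols_def)

lemma cols_Suc_mono: "cols n \<subseteq> cols (Suc n)"
  by (force simp: cols_def)

lemma cell_in_columns [simp]: "cell i k \<in> columns c \<longleftrightarrow> k \<in> c i"
  by (auto simp: columns_def)

text \<open>A relation, not a function: different extensions of the condition can make
  \<open>f\<close> converge to different values.\<close>

definition ext_value ::
  "nat \<Rightarrow> nat \<Rightarrow> nat set \<Rightarrow> recf \<Rightarrow> (nat \<Rightarrow> nat set) \<Rightarrow> nat \<Rightarrow> nat \<Rightarrow> bool" where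
  "ext_value n N X f c x y \<longleftrightarrow> (\<exists>E. ext N X (cols n) (columns c) E \<and> oeval E f [x] y)"

text \<open>\<open>D\<close> is read off from the first \<open>n\<close> sets of \<open>c\<close> by searching for any extension of a fixed
  condition on which \<open>f\<close> converges. This implies that \<open>D\<close> is Turing reducible to the join of these
  sets; working with the definition itself avoids having to program the search.\<close>

definition ext_computable :: "nat \<Rightarrow> (nat \<Rightarrow> nat set) \<Rightarrow> nat set \<Rightarrow> bool" where
  "ext_computable n c D \<longleftrightarrow>
    (\<exists>N xs f. \<forall>x y. ext_value n N (set xs) f c x y \<longleftrightarrow> y = chi D x)"

text \<open>Only a finite part of the witness \<open>E\<close> matters. It is kept below a bound
  covering the condition and the use, and refilled from \<open>c'\<close> above it; since
  \<open>k \<le> cell i k\<close>, the kept part still fits \<open>c'\<close> in the first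
  \<open>n\<close> columns.\<close>

lemma ext_value_continuous:
  assumes "ext_value n N X f c x y"
  shows "\<exists>m. \<forall>c'. (\<forall>i<n. \<forall>a<m. a \<in> c' i \<longleftrightarrow> a \<in> c i) \<longrightarrow> ext_value n N X f c' x y"
proof -
  obtain E where E: "ext N X (cols n) (columns c) E" "oeval E f [x] y"
    using assms unfolding ext_value_def by blast
  obtain u where u: "\<And>B. \<forall>a<u. a \<in> B \<longleftrightarrow> a \<in> E \<Longrightarrow> oeval B f [x] y"
    using oeval_use[OF E(2)] by blast
  define m where "m = max N u"
  show ?thesis
  proof (intro exI[of _ m] allI impI)
    fix c' assume c': "\<forall>i<n. \<forall>a<m. a \<in> c' i \<longleftrightarrow> a \<in> c i"
    define E' where "E' = {a. if a < m then a \<in> E else a \<in> columns c'}"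
    have "a \<in> E' \<longleftrightarrow> a \<in> columns c'" if a: "N \<le> a" "a \<in> cols n" for a
    proof -
      obtain i k where ik: "a = cell i k" "i < n" using a(2) unfolding cols_def by blast
      have "k \<le> a" using le_cell ik by simp
      then show ?thesis using ik E(1) a c' by (auto simp: E'_def ext_def)
    qed
    then have "ext N X (cols n) (columns c') E'"
      using E(1) by (auto simp: ext_def E'_def m_def)
    moreover have "oeval E' f [x] y"
      by (rule u) (simp add: E'_def m_def less_max_iff_disj)
    ultimately show "ext_value n N X f c' x y" unfolding ext_value_def by blast
  qed
qed

text \<open>Under the empty condition column 0 of every extension is \<open>A\<close> itself, so a
  program reading that column answers alike on all of them.\<close>

lemma ext_computable_single: "ext_computable 1 (\<lambda>_. A) A"
proof -
  let ?f = "Cn Oracle [cell_prog 0]"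
  have "ext_value 1 0 (set []) ?f (\<lambda>_. A) x y \<longleftrightarrow> y = chi A x" for x y
  proof -
    have col: "oeval E ?f [x] (chi A x)"
      if "ext 0 (set []) (cols 1) (columns (\<lambda>_. A)) E" for E
    proof -
      have "{k. cell 0 k \<in> E} = A"
        using that by (auto simp: ext_def simp del: cell.simps)
      then show ?thesis using oeval_column[of E 0 x] by simp
    qed
    then show ?thesis
      unfolding ext_value_def
      using oeval_deterministic[OF col] ext_exists[of 0 "set []" "cols 1" "columns (\<lambda>_. A)"] by auto
  qed
  then show ?thesis
    unfolding ext_computable_def by (intro exI[of _ 0] exI[of _ "[]"] exI[of _ ?f] allI)
qed

text \<open>Diagonalisation with nothing frozen against countably many functionals. Continuity makes
  a disagreement survive all further extensions.\<close>

lemma independent_of_functionals: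
  fixes \<Phi> :: "nat \<Rightarrow> (nat \<Rightarrow> nat set) \<Rightarrow> nat \<Rightarrow> nat \<Rightarrow> bool" and n :: "nat \<Rightarrow> nat"
  assumes cont: "\<And>k c x y. \<Phi> k c x y \<Longrightarrow>
    \<exists>m. \<forall>c'. (\<forall>i<n k. \<forall>a<m. a \<in> c' i \<longleftrightarrow> a \<in> c i) \<longrightarrow> \<Phi> k c' x y"
  shows "\<exists>p :: (nat \<Rightarrow> bool) \<Rightarrow> nat set. \<forall>k i j. i \<notin> j ` {..<n k} \<longrightarrow>
    \<not> (\<forall>x y. \<Phi> k (\<lambda>u. p (j u)) x y \<longleftrightarrow> y = chi (p i) x)"
proof -
  have cong: "\<Phi> k c' x y" if "\<Phi> k c x y" "\<And>i. i < n k \<Longrightarrow> c' i = c i" for k c c' x y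
    using cont[OF that(1)] that(2) by auto
  define req where "req v Y \<longleftrightarrow> (case v of (k, s, t) \<Rightarrow>
      \<not> (\<forall>x y. \<Phi> k (\<lambda>u. Y (t ! u)) x y \<longleftrightarrow> y = chi (Y s) x))"
    for v :: "nat \<times> bool list \<times> bool list list" and Y
  \<comment> \<open>Level \<open>l\<close> treats the functionals up to \<open>l\<close>, for every
    target node \<open>s\<close> and every tuple \<open>t\<close> of input nodes avoiding
    \<open>s\<close>: finitely many requirements.\<close>
  define F where "F l = (SIGMA k : {..l}. SIGMA s : strings l.
      {t. set t \<subseteq> strings l \<and> length t = n k \<and> s \<notin> set t})" for l
  have fin: "finite (F l)" for l
    unfolding F_def
    by (intro finite_SigmaI finite_strings finite_atMost)
      (rule finite_subset[OF _ finite_lists_length_eq[OF finite_strings]], blast)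
  have dense1: "densely {} {} (strings l) (req v)" if v: "v \<in> F l" for l v
    unfolding densely_def
  proof (intro allI)
    fix N :: nat and X :: "bool list \<Rightarrow> nat set"
    obtain k s t where kst: "v = (k, s, t)" "s \<in> strings l" "set t \<subseteq> strings l" "length t = n k"
      "s \<notin> set t"
      using v unfolding F_def by blast
    show "\<exists>N' X'. N \<le> N' \<and> (\<forall>s\<in>strings l. ext N (X s) {} {} (X' s)) \<and>
        (\<forall>Y. (\<forall>s\<in>strings l. ext N' (X' s) {} {} (Y s)) \<longrightarrow> req v Y)"
    proof (cases "\<exists>Z y. (\<forall>s\<in>strings l. ext N (X s) {} {} (Z s)) \<and> \<Phi> k (\<lambda>u. Z (t ! u)) N y")
      case True
      then obtain Z y where Z: "\<And>s. s \<in> strings l \<Longrightarrow> ext N (X s) {} {} (Z s)"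
        "\<Phi> k (\<lambda>u. Z (t ! u)) N y" by blast
      \<comment> \<open>Position \<open>N\<close> is the first undecided one. Bit \<open>N\<close>
        at the target \<open>s\<close> is set against the value \<open>y\<close>; the inputs are
        unaffected because \<open>s\<close> is not among them.\<close>
      define X' where "X' = Z(s := (if y = 0 then insert N (Z s) else Z s - {N}))"
      have "X' (t ! u) = Z (t ! u)" if "u < n k" for u
        using that kst(4,5) nth_mem[of u t] unfolding X'_def by (metis fun_upd_other)
      then have "\<Phi> k (\<lambda>u. X' (t ! u)) N y" by (rule cong[OF Z(2)])
      from cont[OF this] obtain m where m: "\<And>c'. (\<forall>i<n k. \<forall>a<m. a \<in> c' i \<longleftrightarrow> a \<in> X' (t ! i)) \<Longrightarrow> \<Phi> k c' N y"
        by blast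
      have "req v Y" if Y: "\<forall>s\<in>strings l. ext (max m (Suc N)) (X' s) {} {} (Y s)" for Y
      proof -
        have "t ! i \<in> strings l" if "i < n k" for i
          using subsetD[OF kst(3) nth_mem] kst(4) that by simp
        then have "\<Phi> k (\<lambda>u. Y (t ! u)) N y"
          using Y by (intro m) (auto simp: ext_def)
        moreover have "N \<in> Y s \<longleftrightarrow> N \<in> X' s"
          using Y kst(2) by (auto simp: ext_def)
        then have "y \<noteq> chi (Y s) N" by (auto simp: X'_def)
        ultimately show ?thesis unfolding req_def kst(1) prod.case by blast
      qed
      moreover have "ext N (X s') {} {} (X' s')" if "s' \<in> strings l" for s'
        using Z(1)[OF that] by (auto simp: ext_def X'_def)
      ultimately show ?thesis
        by (intro exI[of _ "max m (Suc N)"] exI[of _ X']) auto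
    next
      case False
      \<comment> \<open>No extension gives the functional a value at \<open>N\<close>, so it cannot
        be a characteristic function.\<close>
      have "req v Y" if Y: "\<forall>s\<in>strings l. ext N (X s) {} {} (Y s)" for Y
        unfolding req_def kst(1) prod.case
      proof
        assume "\<forall>x y. \<Phi> k (\<lambda>u. Y (t ! u)) x y \<longleftrightarrow> y = chi (Y s) x"
        then have "\<Phi> k (\<lambda>u. Y (t ! u)) N (chi (Y s) N)" by blast
        with False Y show False by blast
      qed
      then show ?thesis by (intro exI[of _ N] exI[of _ X]) (auto simp: ext_def)
    qed
  qed
  have dense: "densely {} {} (strings l) (\<lambda>Y. \<forall>v\<in>F l. req v Y)" for l
    by (rule densely_ball[OF fin dense1])
  obtain p where p: "\<forall>Z. finite Z \<longrightarrow> (\<exists>l0. \<forall>l\<ge>l0. inj_on (restr l) Z \<and>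
      (\<exists>Y. (\<forall>v\<in>F l. req v Y) \<and> (\<forall>z\<in>Z. Y (restr l z) = p z)))"
    using fusion[of "\<lambda>_. {}" "{}" "\<lambda>l Y. \<forall>v\<in>F l. req v Y", OF subset_refl dense]
    by (elim exE conjE)
  show ?thesis
  proof (intro exI[of _ p] allI impI)
    fix k and i :: "nat \<Rightarrow> bool" and j :: "nat \<Rightarrow> nat \<Rightarrow> bool"
    assume i: "i \<notin> j ` {..<n k}"
    let ?Z = "insert i (j ` {..<n k})"
    obtain l0 where l0: "\<forall>l\<ge>l0. inj_on (restr l) ?Z \<and>
        (\<exists>Y. (\<forall>v\<in>F l. req v Y) \<and> (\<forall>z\<in>?Z. Y (restr l z) = p z))"
      using p[rule_format, of ?Z] by auto
    \<comment> \<open>Late enough for \<open>\<Phi> k\<close> to be treated and for the branches to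
      be separated.\<close>
    define l where "l = max k l0"
    have "l \<ge> l0" by (simp add: l_def)
    from l0[rule_format, OF this] obtain Y where inj: "inj_on (restr l) ?Z"
      and Y: "\<forall>v\<in>F l. req v Y" "\<forall>z\<in>?Z. Y (restr l z) = p z"
      by (elim exE conjE)
    define t where "t = map (\<lambda>u. restr l (j u)) [0..<n k]"
    have "restr l i \<notin> set t"
    proof
      assume "restr l i \<in> set t"
      then obtain u where u: "u < n k" "restr l i = restr l (j u)" unfolding t_def by auto
      then have "i = j u" using inj_onD[OF inj, of i "j u"] by simp
      with u(1) i show False by blast
    qed
    then have "(k, restr l i, t) \<in> F l" by (auto simp: F_def l_def t_def)
    then have "req (k, restr l i, t) Y" using Y(1) by blast
    moreover have "\<Phi> k (\<lambda>u. Y (t ! u)) x y \<longleftrightarrow> \<Phi> k (\<lambda>u. p (j u)) x y" for x y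
    proof -
      have same: "Y (t ! u) = p (j u)" if "u < n k" for u
        using that bspec[OF Y(2), of "j u"] by (simp add: t_def)
      show ?thesis by (intro iffI; erule cong) (simp_all add: same)
    qed
    ultimately show "\<not> (\<forall>x y. \<Phi> k (\<lambda>u. p (j u)) x y \<longleftrightarrow> y = chi (p i) x)"
      using bspec[OF Y(2), of i] unfolding req_def by simp
  qed
qed

lemma independent_family:
  obtains p :: "(nat \<Rightarrow> bool) \<Rightarrow> nat set"
  where "\<And>n i j D. ext_computable n (\<lambda>u. p (j u)) D \<Longrightarrow> i \<notin> j ` {..<n} \<Longrightarrow> \<not> p i \<le>\<^sub>T D"
proof -
  \<comment> \<open>The search for \<open>D\<close> and the reduction \<open>g\<close> are merged
    into one continuous functional, which finds an initial segment of \<open>D\<close> that suffices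
    for \<open>g\<close>. The data \<open>v\<close> range over a countable type, the finite part of
    the condition being a list.\<close>
  define \<Psi> where "\<Psi> v c x y \<longleftrightarrow> (case v of (n, N, xs, f, g) \<Rightarrow>
      \<exists>m D. (\<forall>a<m. ext_value n N (set xs) f c a (chi D a)) \<and>
        (\<forall>D'. (\<forall>a<m. a \<in> D' \<longleftrightarrow> a \<in> D) \<longrightarrow> oeval D' g [x] y))"
    for v :: "nat \<times> nat \<times> nat list \<times> recf \<times> recf" and c x y
  have cont: "\<exists>b. \<forall>c'. (\<forall>i<fst v. \<forall>a<b. a \<in> c' i \<longleftrightarrow> a \<in> c i) \<longrightarrow> \<Psi> v c' x y"
    if \<Psi>: "\<Psi> v c x y" for v c x y
  proof -
    obtain n N xs f g where v: "v = (n, N, xs, f, g)" by (cases v)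
    obtain m D where m: "\<forall>a<m. ext_value n N (set xs) f c a (chi D a)"
      and D: "\<forall>D'. (\<forall>a<m. a \<in> D' \<longleftrightarrow> a \<in> D) \<longrightarrow> oeval D' g [x] y"
      using \<Psi>[unfolded \<Psi>_def v prod.case] by (elim exE conjE)
    have "\<exists>b. \<forall>c'. (\<forall>i<n. \<forall>a'<b. a' \<in> c' i \<longleftrightarrow> a' \<in> c i) \<longrightarrow>
        ext_value n N (set xs) f c' a (chi D a)" if "a < m" for a
      using that m by (intro ext_value_continuous) simp
    then obtain b where b: "\<And>a c'. a < m \<Longrightarrow> (\<forall>i<n. \<forall>a'<b a. a' \<in> c' i \<longleftrightarrow> a' \<in> c i) \<Longrightarrow>
        ext_value n N (set xs) f c' a (chi D a)"
      by metis
    have "\<Psi> v c' x y" if "\<forall>i<fst v. \<forall>a<(\<Sum>a<m. b a). a \<in> c' i \<longleftrightarrow> a \<in> c i" for c'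
    proof -
      have "ext_value n N (set xs) f c' a (chi D a)" if "a < m" for a
      proof (rule b[OF that])
        have "b a \<le> (\<Sum>a<m. b a)" using that by (intro member_le_sum) auto
        then show "\<forall>i<n. \<forall>a'<b a. a' \<in> c' i \<longleftrightarrow> a' \<in> c i"
          using \<open>\<forall>i<fst v. _\<close> v by auto
      qed
      then show ?thesis unfolding \<Psi>_def v prod.case using D by blast
    qed
    then show ?thesis by blast
  qed
  have "\<exists>p :: (nat \<Rightarrow> bool) \<Rightarrow> nat set. \<forall>k i j.
      i \<notin> j ` {..<fst (from_nat k :: nat \<times> nat \<times> nat list \<times> recf \<times> recf)} \<longrightarrow>
      \<not> (\<forall>x y. \<Psi> (from_nat k) (\<lambda>u. p (j u)) x y \<longleftrightarrow> y = chi (p i) x)"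
    by (rule independent_of_functionals) (rule cont)
  then obtain p :: "(nat \<Rightarrow> bool) \<Rightarrow> nat set" where p: "\<forall>k i j.
      i \<notin> j ` {..<fst (from_nat k :: nat \<times> nat \<times> nat list \<times> recf \<times> recf)} \<longrightarrow>
      \<not> (\<forall>x y. \<Psi> (from_nat k) (\<lambda>u. p (j u)) x y \<longleftrightarrow> y = chi (p i) x)"
    by (elim exE)
  show ?thesis
  proof (rule that, rule notI)
    fix n i j D
    assume "ext_computable n (\<lambda>u. p (j u)) D" and i: "i \<notin> j ` {..<n}" and "p i \<le>\<^sub>T D"
    then obtain N xs f g
      where f: "\<And>x y. ext_value n N (set xs) f (\<lambda>u. p (j u)) x y \<longleftrightarrow> y = chi D x"
        and g: "\<And>x. oeval D g [x] (chi (p i) x)"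
      unfolding ext_computable_def turing_reducible_def by blast
    have "\<Psi> (n, N, xs, f, g) (\<lambda>u. p (j u)) x y \<longleftrightarrow> y = chi (p i) x" for x y
    proof
      assume "\<Psi> (n, N, xs, f, g) (\<lambda>u. p (j u)) x y"
      then obtain m D' where "\<And>a. a < m \<Longrightarrow> chi D' a = chi D a"
        and D': "\<And>D''. (\<forall>a<m. a \<in> D'' \<longleftrightarrow> a \<in> D') \<Longrightarrow> oeval D'' g [x] y"
        unfolding \<Psi>_def f prod.case by blast
      then have "\<forall>a<m. a \<in> D \<longleftrightarrow> a \<in> D'" by (metis zero_neq_one)
      then show "y = chi (p i) x" by (rule oeval_deterministic[OF g D'])
    next
      assume "y = chi (p i) x"
      then obtain m where "\<And>B. \<forall>a<m. a \<in> B \<longleftrightarrow> a \<in> D \<Longrightarrow> oeval B g [x] y"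
        using oeval_use[OF g[of x]] by blast
      then show "\<Psi> (n, N, xs, f, g) (\<lambda>u. p (j u)) x y"
        unfolding \<Psi>_def f prod.case by (intro exI[of _ m] exI[of _ D]) simp
    qed
    with p[rule_format, of i j "to_nat (n, N, xs, f, g)"] i show False by simp
  qed
qed

text \<open>Column \<open>i\<close> is frozen to \<open>c i\<close> from level \<open>Suc i\<close>
  on. For programs at two distinct nodes, either some extensions disagree and the disagreement is
  preserved, or a set computed at both nodes can be found by searching through the extensions at the
  first.\<close>

lemma exact_family:
  fixes c :: "nat \<Rightarrow> nat set"
  obtains B :: "(nat \<Rightarrow> bool) \<Rightarrow> nat set"
  where "\<And>z i. c i \<le>\<^sub>T B z"
    and "\<And>z w D. z \<noteq> w \<Longrightarrow> D \<le>\<^sub>T B z \<Longrightarrow> D \<le>\<^sub>T B w \<Longrightarrow> \<exists>n. ext_computable n c D"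
proof -
  define req where "req v Y \<longleftrightarrow> (case v of (f, g, s, t) \<Rightarrow>
      \<forall>D. (\<forall>x. oeval (Y s) f [x] (chi D x)) \<longrightarrow> (\<forall>x. oeval (Y t) g [x] (chi D x)) \<longrightarrow>
        (\<exists>n. ext_computable n c D))"
    for v :: "recf \<times> recf \<times> bool list \<times> bool list" and Y
  define F where "F l = {(f :: recf, g :: recf, s, t). f \<in> from_nat ` {..l} \<and> g \<in> from_nat ` {..l} \<and>
      s \<in> strings l \<and> t \<in> strings l \<and> s \<noteq> t}" for l
  have fin: "finite (F l)" for l
  proof (rule finite_subset)
    show "F l \<subseteq> from_nat ` {..l} \<times> from_nat ` {..l} \<times> strings l \<times> strings l"
      unfolding F_def by blast
  qed (simp add: finite_strings)
  have dense1: "densely (cols l) (columns c) (strings l) (req v)" if v: "v \<in> F l" for l v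
    unfolding densely_def
  proof (intro allI)
    fix N :: nat and X :: "bool list \<Rightarrow> nat set"
    obtain f g s t where fgst: "v = (f, g, s, t)" "s \<in> strings l" "t \<in> strings l" "s \<noteq> t"
      using v unfolding F_def by blast
    let ?ext = "\<lambda>N X. ext N X (cols l) (columns c)"
    have "\<forall>s. \<exists>E. ?ext N (X s) E" using ext_exists by blast
    then obtain X0 where X0: "\<forall>s. ?ext N (X s) (X0 s)" by (rule choice[THEN exE])
    show "\<exists>N' X'. N \<le> N' \<and> (\<forall>s\<in>strings l. ?ext N (X s) (X' s)) \<and>
        (\<forall>Y. (\<forall>s\<in>strings l. ?ext N' (X' s) (Y s)) \<longrightarrow> req v Y)"
    proof (cases "\<exists>E E' x y y'. ?ext N (X s) E \<and> ?ext N (X t) E' \<and> oeval E f [x] y \<and>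
        oeval E' g [x] y' \<and> y \<noteq> y'")
      case True
      then obtain E E' x y y' where E: "?ext N (X s) E" "?ext N (X t) E'" "oeval E f [x] y"
        "oeval E' g [x] y'" "y \<noteq> y'" by blast
      obtain m where m: "\<And>B. \<forall>a<m. a \<in> B \<longleftrightarrow> a \<in> E \<Longrightarrow> oeval B f [x] y"
        using oeval_use[OF E(3)] by blast
      obtain m' where m': "\<And>B. \<forall>a<m'. a \<in> B \<longleftrightarrow> a \<in> E' \<Longrightarrow> oeval B g [x] y'"
        using oeval_use[OF E(4)] by blast
      define X' where "X' = X0(s := E, t := E')"
      define N' where "N' = max N (max m m')"
      have "req v Y" if "\<forall>s\<in>strings l. ?ext N' (X' s) (Y s)" for Y
      proof -
        have "?ext N' E (Y s)" "?ext N' E' (Y t)"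
          using that fgst(2-4) by (auto simp: X'_def split: if_splits)
        then have "oeval (Y s) f [x] y" "oeval (Y t) g [x] y'"
          by (auto intro!: m m' simp: ext_def N'_def)
        then have False if "\<forall>x. oeval (Y s) f [x] (chi D x)" "\<forall>x. oeval (Y t) g [x] (chi D x)" for D
          using oeval_deterministic[OF _ that(1)[rule_format, of x]]
            oeval_deterministic[OF _ that(2)[rule_format, of x]] E(5) by metis
        then show ?thesis unfolding req_def fgst(1) prod.case by blast
      qed
      moreover have "?ext N (X s') (X' s')" for s'
        using X0 E(1,2) by (simp add: X'_def)
      ultimately show ?thesis
        by (intro exI[of _ N'] exI[of _ X']) (auto simp: N'_def)
    next
      case False
      \<comment> \<open>Without disagreement, any value of \<open>f\<close> on an extension of
        \<open>X s\<close> equals the value of \<open>g\<close> on \<open>Y t\<close>, which is that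
        of \<open>D\<close>; and \<open>Y s\<close> is itself such an extension.\<close>
      have "req v Y" if Y: "\<forall>s\<in>strings l. ?ext N (X0 s) (Y s)" for Y
        unfolding req_def fgst(1) prod.case
      proof (intro allI impI)
        fix D assume D: "\<forall>x. oeval (Y s) f [x] (chi D x)" "\<forall>x. oeval (Y t) g [x] (chi D x)"
        have Ys: "?ext N (X s') (Y s')" if "s' \<in> strings l" for s'
          using X0 Y that ext_mono by blast
        obtain xs where xs: "set xs = X s \<inter> {..<N}"
          using finite_list[of "X s \<inter> {..<N}"] by auto
        have same: "?ext N (set xs) E \<longleftrightarrow> ?ext N (X s) E" for E
          unfolding ext_def xs by auto
        have "ext_value l N (set xs) f c x y \<longleftrightarrow> y = chi D x" for x y
          unfolding ext_value_def same
        proof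
          assume "\<exists>E. ?ext N (X s) E \<and> oeval E f [x] y"
          then show "y = chi D x" using False Ys[OF fgst(3)] D(2) by blast
        next
          assume "y = chi D x"
          then show "\<exists>E. ?ext N (X s) E \<and> oeval E f [x] y" using Ys[OF fgst(2)] D(1) by blast
        qed
        then show "\<exists>n. ext_computable n c D" unfolding ext_computable_def by (intro exI allI)
      qed
      then show ?thesis using X0 by blast
    qed
  qed
  have dense: "densely (cols l) (columns c) (strings l) (\<lambda>Y. \<forall>v\<in>F l. req v Y)" for l
    by (rule densely_ball[OF fin dense1])
  obtain B where B: "\<forall>l z. \<exists>N X. ext N X (cols l) (columns c) (B z)"
    and req: "\<forall>Z. finite Z \<longrightarrow> (\<exists>l0. \<forall>l\<ge>l0. inj_on (restr l) Z \<and>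
      (\<exists>Y. (\<forall>v\<in>F l. req v Y) \<and> (\<forall>z\<in>Z. Y (restr l z) = B z)))"
    using fusion[of cols "columns c" "\<lambda>l Y. \<forall>v\<in>F l. req v Y", OF cols_Suc_mono dense]
    by (elim exE conjE)
  show ?thesis
  proof (rule that)
    fix z i
    \<comment> \<open>Column \<open>i\<close> is frozen above \<open>N\<close> here, so it differs
      from \<open>c i\<close> in finitely many places only.\<close>
    obtain N X where N: "ext N X (cols (Suc i)) (columns c) (B z)" using B by blast
    have "k \<in> c i \<longleftrightarrow> k \<in> {k. cell i k \<in> B z}" if "k \<ge> N" for k
      using N that le_cell[of k i] by (simp add: ext_def)
    then have "c i \<le>\<^sub>T {k. cell i k \<in> B z}" by (rule turing_reducible_finite_change)
    then show "c i \<le>\<^sub>T B z" using turing_reducible_column turing_reducible_trans by blast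
  next
    fix z w D assume zw: "z \<noteq> w" and "D \<le>\<^sub>T B z" "D \<le>\<^sub>T B w"
    then obtain f g where f: "\<forall>x. oeval (B z) f [x] (chi D x)"
      and g: "\<forall>x. oeval (B w) g [x] (chi D x)"
      unfolding turing_reducible_def by blast
    obtain l0 where l0: "\<forall>l\<ge>l0. inj_on (restr l) {z, w} \<and>
        (\<exists>Y. (\<forall>v\<in>F l. req v Y) \<and> (\<forall>z\<in>{z, w}. Y (restr l z) = B z))"
      using req[rule_format, of "{z, w}"] by auto
    define l where "l = max l0 (max (to_nat f) (to_nat g))"
    have "l \<ge> l0" by (simp add: l_def)
    from l0[rule_format, OF this] obtain Y where inj: "inj_on (restr l) {z, w}"
      and Y: "\<forall>v\<in>F l. req v Y" "\<forall>z\<in>{z, w}. Y (restr l z) = B z"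
      by (elim exE conjE)
    have "f \<in> from_nat ` {..l}" "g \<in> from_nat ` {..l}"
      by (auto simp: l_def intro!: image_eqI[of f _ "to_nat f"] image_eqI[of g _ "to_nat g"])
    moreover have "restr l z \<noteq> restr l w"
      using inj_onD[OF inj, of z w] zw by blast
    ultimately have "(f, g, restr l z, restr l w) \<in> F l" by (simp add: F_def)
    then have "req (f, g, restr l z, restr l w) Y" using Y(1) by blast
    then show "\<exists>n. ext_computable n c D" using f g Y(2) unfolding req_def by simp
  qed
qed

section \<open>Embedding by transfinite choice\<close>

unbundle cardinal_syntax

section \<open>Cardinality of Cantor space\<close>

lemma uncountable_cantor_space: "uncountable (UNIV :: (nat \<Rightarrow> bool) set)"
proof
  assume "countable (UNIV :: (nat \<Rightarrow> bool) set)"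
  then obtain g :: "nat \<Rightarrow> nat \<Rightarrow> bool" where g: "range g = UNIV"
    using uncountable_def by blast
  then obtain n where "(\<lambda>k. \<not> g k k) = g n" by (metis UNIV_I imageE)
  from fun_cong[OF this, of n] show False by simp
qed

lemma infinite_cantor_space: "infinite (UNIV :: (nat \<Rightarrow> bool) set)"
  using uncountable_cantor_space uncountable_infinite by blast

text \<open>The union has at most |I| + aleph_0 elements, and a sum of two cardinals below the
  continuum stays below it.\<close>

lemma avoid_countable_sets:
  fixes Bad :: "'a \<Rightarrow> (nat \<Rightarrow> bool) set"
  assumes I: "|I| <o |UNIV :: (nat \<Rightarrow> bool) set|"
    and countable: "\<And>i. i \<in> I \<Longrightarrow> countable (Bad i)"
  shows "\<exists>z. \<forall>i\<in>I. z \<notin> Bad i"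
proof -
  let ?K = "I <+> (UNIV :: nat set)"
  have "\<not> |UNIV :: (nat \<Rightarrow> bool) set| \<le>o |UNIV :: nat set|"
    using uncountable_cantor_space unfolding card_of_ordLeq[symmetric] countable_def by blast
  then have "|UNIV :: nat set| <o |UNIV :: (nat \<Rightarrow> bool) set|"
    by (simp add: not_ordLeq_iff_ordLess card_of_Well_order)
  with I have K: "|?K| <o |UNIV :: (nat \<Rightarrow> bool) set|"
    by (rule card_of_Plus_ordLess_infinite[OF infinite_cantor_space])
  have nat_le: "|UNIV :: nat set| \<le>o |?K|" by (rule card_of_Plus2)
  have "|\<Union>i\<in>I. Bad i| \<le>o |?K|"
  proof (rule card_of_UNION_ordLeq_infinite)
    show "infinite ?K" by (simp add: finite_Plus_iff)
    show "|I| \<le>o |?K|" by (rule card_of_Plus1)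
    show "\<forall>i\<in>I. |Bad i| \<le>o |?K|"
    proof
      fix i assume "i \<in> I"
      then have "|Bad i| \<le>o |UNIV :: nat set|"
        using countable unfolding card_of_ordLeq[symmetric] countable_def by blast
      then show "|Bad i| \<le>o |?K|" using nat_le ordLeq_transitive by blast
    qed
  qed
  then have "|\<Union>i\<in>I. Bad i| <o |UNIV :: (nat \<Rightarrow> bool) set|"
    using K ordLeq_ordLess_trans by blast
  then have "(\<Union>i\<in>I. Bad i) \<noteq> UNIV" using ordLess_irreflexive by metis
  then show ?thesis by blast
qed

text \<open>Bit 0 is set, odd positions carry \<open>v\<close> and positive even ones
  \<open>z\<close> (hence the \<open>- 1\<close>). Here \<open>v\<close> will be the tag of an
  element and \<open>z\<close> its free choice.\<close>

definition pack :: "(nat \<Rightarrow> bool) \<Rightarrow> (nat \<Rightarrow> bool) \<Rightarrow> nat \<Rightarrow> bool" where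
  "pack v z k = (k = 0 \<or> (if odd k then v (k div 2) else z (k div 2 - 1)))"

text \<open>Bit 0 is clear, which keeps these indices apart from all values of \<open>pack\<close>;
  they are reserved for coding into upper sets.\<close>

definition spike :: "nat \<Rightarrow> nat \<Rightarrow> bool" where
  "spike n k = (k = Suc n)"

lemma pack_inject [simp]: "pack v z = pack v' z' \<longleftrightarrow> v = v' \<and> z = z'"
proof
  assume eq: "pack v z = pack v' z'"
  have "v m = v' m" for m using fun_cong[OF eq, of "Suc (2 * m)"] by (simp add: pack_def)
  moreover have "z m = z' m" for m using fun_cong[OF eq, of "2 * Suc m"] by (simp add: pack_def)
  ultimately show "v = v' \<and> z = z'" by blast
qed simp

lemma spike_inject: "spike m = spike n \<longleftrightarrow> m = n"
  by (auto simp: spike_def dest: fun_cong[of _ _ "Suc m"])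

lemma pack_neq_spike [simp]: "pack v z \<noteq> spike n" "spike n \<noteq> pack v z"
  by (auto simp: pack_def spike_def dest: fun_cong[of _ _ 0])

text \<open>Each \<open>y\<close> has a candidate \<open>H f y z\<close> for every \<open>z\<close>
  in Cantor space; its image is \<open>H f y (f y)\<close>, with \<open>f\<close> found by
  well-founded recursion. The candidates of an upper element depend on the choices made below
  it.\<close>

lemma two_level_embedding:
  fixes L U :: "'a set" and below :: "'a \<Rightarrow> 'a set"
  assumes disj: "L \<inter> U = {}"
    and below: "\<And>u. u \<in> U \<Longrightarrow> below u \<subseteq> L" "\<And>u. u \<in> U \<Longrightarrow> countable (below u)"
      "\<And>u. u \<in> U \<Longrightarrow> below u \<noteq> {}"
    and card: "|L \<union> U| \<le>o |UNIV :: (nat \<Rightarrow> bool) set|"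
  obtains G :: "'a \<Rightarrow> nat set"
  where "\<And>x y. x \<in> L \<union> U \<Longrightarrow> y \<in> L \<union> U \<Longrightarrow>
    G x \<le>\<^sub>T G y \<longleftrightarrow> x = y \<or> y \<in> U \<and> x \<in> below y"
proof -
  define P where "P = L \<union> U"
  define le where "le x y \<longleftrightarrow> x = y \<or> y \<in> U \<and> x \<in> below y" for x y
  obtain h :: "'a \<Rightarrow> nat \<Rightarrow> bool" where h: "inj_on h P"
    using card unfolding P_def card_of_ordLeq[symmetric] by blast
  obtain p :: "(nat \<Rightarrow> bool) \<Rightarrow> nat set" where p:
    "\<And>n i j D. ext_computable n (\<lambda>u. p (j u)) D \<Longrightarrow> i \<notin> j ` {..<n} \<Longrightarrow> \<not> p i \<le>\<^sub>T D"
    using independent_family by blast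
  have p_le: "i = j" if "p i \<le>\<^sub>T p j" for i j
    using p[of 1 "\<lambda>_. j" "p j" i] ext_computable_single that by auto
  have "\<exists>B :: (nat \<Rightarrow> bool) \<Rightarrow> nat set. (\<forall>z i. c i \<le>\<^sub>T B z) \<and>
      (\<forall>z w D. z \<noteq> w \<longrightarrow> D \<le>\<^sub>T B z \<longrightarrow> D \<le>\<^sub>T B w \<longrightarrow> (\<exists>n. ext_computable n c D))" for c
    by (rule exact_family[of c]) blast
  then obtain B :: "(nat \<Rightarrow> nat set) \<Rightarrow> (nat \<Rightarrow> bool) \<Rightarrow> nat set" where B: "\<And>c z i. c i \<le>\<^sub>T B c z"
    and exact: "\<And>c z w D. z \<noteq> w \<Longrightarrow> D \<le>\<^sub>T B c z \<Longrightarrow> D \<le>\<^sub>T B c w \<Longrightarrow> \<exists>n. ext_computable n c D"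
    by metis
  define low where "low u n = from_nat_into (below u) n" for u n
  have low: "low u n \<in> below u" if "u \<in> U" for u n
    unfolding low_def using below(3)[OF that] by (rule from_nat_into)
  have low_surj: "\<exists>n. x = low u n" if "u \<in> U" "x \<in> below u" for u x
    unfolding low_def using from_nat_into_surj[OF below(2) that(2)] that(1) by metis
  \<comment> \<open>Besides the sets below \<open>u\<close>, every upper set codes the infinitely many \<open>p (spike m)\<close>; hence it is
    not computable from any finitely many members of the independent family.\<close>
  define J where "J f u n = (if even n then spike (n div 2)
      else pack (h (low u (n div 2))) (f (low u (n div 2))))" for f u n
  define H where "H f y z = (if y \<in> U then B (\<lambda>n. p (J f y n)) z else p (pack (h y) z))" for f y z
  have H_spike: "p (spike m) \<le>\<^sub>T H f u z" if "u \<in> U" for f u z m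
    using B[of "\<lambda>n. p (J f u n)" "2 * m" z] that by (simp add: H_def J_def)
  have H_below: "p (pack (h x) (f x)) \<le>\<^sub>T H f u z" if u: "u \<in> U" "x \<in> below u" for f u x z
  proof -
    obtain n where "x = low u n" using low_surj[OF u] by blast
    then show ?thesis
      using B[of "\<lambda>n. p (J f u n)" "Suc (2 * n)" z] u by (simp add: H_def J_def)
  qed
  have spikes_not_computable: "\<not> ext_computable n (\<lambda>k. p (J f u k)) D"
    if D: "\<And>m. p (spike m) \<le>\<^sub>T D" for n f u D
  proof
    assume comp: "ext_computable n (\<lambda>k. p (J f u k)) D"
    have "infinite (range spike)"
      by (rule range_inj_infinite) (simp add: inj_def spike_inject)
    then obtain m where "spike m \<notin> J f u ` {..<n}"
      by (metis finite_imageI finite_lessThan finite_subset image_subsetI)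
    then show False using p[OF comp] D by blast
  qed
  \<comment> \<open>The inputs coded into \<open>u\<close> are spikes or carry tags of elements
    below \<open>u\<close>, and \<open>h\<close> separates \<open>y\<close> from those.\<close>
  have L_not_computable: "\<not> ext_computable n (\<lambda>k. p (J f u k)) (p (pack (h y) z))"
    if u: "u \<in> U" and y: "y \<in> L" "y \<notin> below u" for n f u y z
  proof
    assume comp: "ext_computable n (\<lambda>k. p (J f u k)) (p (pack (h y) z))"
    have "J f u k \<noteq> pack (h y) z" for k
    proof -
      have "low u (k div 2) \<in> P" "low u (k div 2) \<noteq> y" "y \<in> P"
        using low[OF u, of "k div 2"] below(1)[OF u] y by (auto simp: P_def)
      then show ?thesis using inj_onD[OF h] by (auto simp: J_def)
    qed
    then have "pack (h y) z \<notin> J f u ` {..<n}" by (metis imageE)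
    then show False using p[OF comp] turing_reducible_refl by blast
  qed
  \<comment> \<open>If two upper candidates coincided, that set would lie below two members of one
    exact family and be computable from finitely many inputs, against the spikes.\<close>
  have H_inj: "inj (H f y)" for f y
  proof (rule injI, rule ccontr)
    fix z w assume eq: "H f y z = H f y w" and "z \<noteq> w"
    show False
    proof (cases "y \<in> U")
      case True
      then have "\<exists>n. ext_computable n (\<lambda>n. p (J f y n)) (H f y z)"
        using exact[OF \<open>z \<noteq> w\<close>, of "H f y z" "\<lambda>n. p (J f y n)"] eq turing_reducible_refl
        by (simp add: H_def)
      then show False using spikes_not_computable H_spike[OF True] by blast
    next
      case False
      then have "p (pack (h y) z) \<le>\<^sub>T p (pack (h y) w)"
        using eq turing_reducible_refl by (simp add: H_def)
      then show False using p_le \<open>z \<noteq> w\<close> by fastforce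
    qed
  qed

  \<comment> \<open>Countability of the excluded candidates\<close>
  define ok where "ok f x y z \<longleftrightarrow> (\<not> le x y \<longrightarrow> \<not> H f x (f x) \<le>\<^sub>T H f y z) \<and>
      (\<not> le y x \<longrightarrow> \<not> H f y z \<le>\<^sub>T H f x (f x))" for f x y z
  \<comment> \<open>If \<open>y\<close> is upper and not above \<open>x\<close>, the image of
    \<open>x\<close> is not computable from finitely many inputs of \<open>y\<close>, so at most one
    \<open>z\<close> puts it below. In the other cases no \<open>z\<close> is excluded.\<close>
  have upper: "countable {z. \<not> le x y \<and> H f x (f x) \<le>\<^sub>T H f y z}"
    if xy: "x \<in> P" "y \<in> P" for f x y
  proof (cases "\<not> le x y \<and> y \<in> U")
    case True
    have nc: "\<not> ext_computable n (\<lambda>k. p (J f y k)) (H f x (f x))" for n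
    proof (cases "x \<in> U")
      case True
      then show ?thesis using spikes_not_computable H_spike by blast
    next
      case False
      then have "x \<in> L" "x \<notin> below y" using xy \<open>\<not> le x y \<and> y \<in> U\<close> by (auto simp: P_def le_def)
      then show ?thesis using L_not_computable \<open>\<not> le x y \<and> y \<in> U\<close> False by (simp add: H_def)
    qed
    have "z = w" if "H f x (f x) \<le>\<^sub>T H f y z" "H f x (f x) \<le>\<^sub>T H f y w" for z w
      using exact[of z w "H f x (f x)" "\<lambda>n. p (J f y n)"] nc that True
      unfolding H_def[of f y] by auto
    then have "finite {z. H f x (f x) \<le>\<^sub>T H f y z}"
      by (metis (mono_tags, lifting) finite.simps finite_subset mem_Collect_eq singletonI subsetI)
    then show ?thesis by (rule countable_subset[OF _ countable_finite, rotated]) blast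
  next
    case False
    have "\<not> H f x (f x) \<le>\<^sub>T H f y z" if "\<not> le x y" for z
    proof
      assume le: "H f x (f x) \<le>\<^sub>T H f y z"
      have y: "y \<notin> U" using False that by blast
      show False
      proof (cases "x \<in> U")
        case True
        then have "p (spike 0) \<le>\<^sub>T p (pack (h y) z)"
          using turing_reducible_trans[OF H_spike le] y by (simp add: H_def)
        then show False using p_le by fastforce
      next
        case False
        then have "pack (h x) (f x) = pack (h y) z" using le y by (intro p_le) (simp add: H_def)
        then have "x = y" using inj_onD[OF h] xy by simp
        then show False using that by (simp add: le_def)
      qed
    qed
    then have "{z. \<not> le x y \<and> H f x (f x) \<le>\<^sub>T H f y z} = {}" by blast
    then show ?thesis by (simp only: countable_empty)
  qed
  have lower: "countable {z. H f y z \<le>\<^sub>T D}" for f y D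
  proof (rule countable_image_inj_on)
    show "countable (H f y ` {z. H f y z \<le>\<^sub>T D})"
      by (rule countable_subset[OF _ countable_lower_cone[of D]]) blast
    show "inj_on (H f y) {z. H f y z \<le>\<^sub>T D}" using H_inj inj_on_subset by blast
  qed
  have bad: "countable {z. \<not> ok f x y z}" if "x \<in> P" "y \<in> P" for f x y
    by (rule countable_subset[OF _ countable_Un[OF upper[OF that, of f] lower[of f y "H f x (f x)"]]])
      (auto simp: ok_def)
  \<comment> \<open>Elements are processed in blocks: block \<open>e\<close> consists of the elements below \<open>e\<close> that did not
    occur earlier, lower ones first.\<close>
  define w where "w = |P|"
  have w: "Well_order w" "Field w = P" "Card_order w"
    unfolding w_def by (rule card_of_Well_order Field_card_of card_of_Card_order)+
  interpret w: wo_rel w by (unfold_locales) (rule w(1))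
  \<comment> \<open>The block of \<open>x\<close>. An upper element is below itself only, hence its
    own block; a lower one may enter long before some upper elements above it.\<close>
  define t where "t x = w.minim {e \<in> P. le x e}" for x
  have t: "t x \<in> P" "le x (t x)" "\<And>e. e \<in> P \<Longrightarrow> le x e \<Longrightarrow> (t x, e) \<in> w" if "x \<in> P" for x
  proof -
    have S: "{e \<in> P. le x e} \<subseteq> Field w" "{e \<in> P. le x e} \<noteq> {}"
      using that w(2) by (auto simp: le_def)
    from w.minim_in[OF S] show "t x \<in> P" "le x (t x)" by (auto simp: t_def)
    show "(t x, e) \<in> w" if "e \<in> P" "le x e" for e
      unfolding t_def using that by (intro w.minim_least[OF S(1)]) simp
  qed
  have t_U: "t u = u" if "u \<in> U" for u
    using t(2)[of u] below(1) disj that by (auto simp: P_def le_def)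
  \<comment> \<open>Processing order: by blocks, and inside a block lower elements before the upper
    one. Lower elements of one block stay unrelated; independence of \<open>p\<close> separates
    them.\<close>
  define R where "R = {(x, y). x \<in> P \<and> y \<in> P \<and>
      ((t x, t y) \<in> w - Id \<or> t x = t y \<and> x \<in> L \<and> y \<in> U)}"
  have wf_w: "wf (w - Id)" using w(1) by (simp add: well_order_on_def)
  have "wf R"
  proof (rule wf_subset)
    let ?M = "inv_image ((w - Id) <*lex*> less_than) (\<lambda>x. (t x, if x \<in> U then 1 else 0 :: nat))"
    show "wf ?M" using wf_w by (intro wf_inv_image wf_lex_prod) auto
    show "R \<subseteq> ?M" using disj by (auto simp: R_def)
  qed
  have R_below: "(x, u) \<in> R" if "u \<in> U" "x \<in> below u" for x u
  proof -
    have x: "x \<in> L" "x \<in> P" "u \<in> P" using that below(1) by (auto simp: P_def)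
    have "(t x, u) \<in> w" using t(3)[OF x(2,3)] that by (simp add: le_def)
    then show ?thesis using x that by (auto simp: R_def t_U)
  qed
  have R_trans: "trans R"
  proof -
    define s where "s = w - Id"
    have s: "trans s" unfolding s_def using w.TRANS w.ANTISYM by (rule trans_diff_Id)
    have R_s: "(x, y) \<in> R \<longleftrightarrow> x \<in> P \<and> y \<in> P \<and> ((t x, t y) \<in> s \<or> t x = t y \<and> x \<in> L \<and> y \<in> U)"
      for x y unfolding R_def s_def by simp
    show ?thesis
    proof (rule transI)
      fix x y z assume "(x, y) \<in> R" "(y, z) \<in> R"
      then show "(x, z) \<in> R"
        unfolding R_s using transD[OF s, of "t x" "t y" "t z"] by auto
    qed
  qed
  \<comment> \<open>\<open>w\<close> is a cardinal order, so its proper initial segments are smaller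
    than \<open>P\<close>.\<close>
  have preds: "|insert e (underS w e)| <o |UNIV :: (nat \<Rightarrow> bool) set|" if "e \<in> P" for e
  proof -
    have "|underS w e| <o |UNIV :: (nat \<Rightarrow> bool) set|"
      using card_of_underS[OF w(3)] that w(2) card ordLess_ordLeq_trans unfolding w_def P_def by metis
    moreover have "|{e}| <o |UNIV :: (nat \<Rightarrow> bool) set|"
      using finite_ordLess_infinite[OF card_of_Well_order card_of_Well_order, of "{e}"
        "UNIV :: (nat \<Rightarrow> bool) set"] infinite_cantor_space by (simp add: Field_card_of)
    ultimately have "|{e} \<union> underS w e| <o |UNIV :: (nat \<Rightarrow> bool) set|"
      using card_of_Un_ordLess_infinite[OF infinite_cantor_space] by blast
    then show ?thesis by simp
  qed

  \<comment> \<open>Well-founded choice of the parameters\<close>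
  have "\<exists>f. \<forall>y. \<forall>x. (x, y) \<in> R \<longrightarrow> ok f x y (f y)"
  proof (rule dependent_wf_choice[OF \<open>wf R\<close>])
    fix f g :: "'a \<Rightarrow> nat \<Rightarrow> bool" and y z
    assume fg: "\<And>x. (x, y) \<in> R \<Longrightarrow> f x = g x"
    \<comment> \<open>\<open>ok f x y z\<close> depends on \<open>f\<close> only at predecessors of
      \<open>y\<close>: an upper set consults \<open>f\<close> at elements below it, which precede
      it in \<open>R\<close>, and \<open>R\<close> is transitive.\<close>
    have J_eq: "J f u = J g u" if "u \<in> U" "u = y \<or> (u, y) \<in> R" for u
    proof -
      have "(low u n, y) \<in> R" for n
        using R_below[OF that(1) low[OF that(1)]] that(2) R_trans by (metis transD)
      then show ?thesis using fg by (auto simp: J_def)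
    qed
    have "H f y z = H g y z" using J_eq by (simp add: H_def)
    moreover have "H f x (f x) = H g x (g x)" if "(x, y) \<in> R" for x
      using J_eq[of x] fg that by (simp add: H_def)
    ultimately show "(\<forall>x. (x, y) \<in> R \<longrightarrow> ok f x y z) = (\<forall>x. (x, y) \<in> R \<longrightarrow> ok g x y z)"
      by (simp add: ok_def)
  next
    fix y and f :: "'a \<Rightarrow> nat \<Rightarrow> bool"
    show "\<exists>z. \<forall>x. (x, y) \<in> R \<longrightarrow> ok f x y z"
    proof (cases "y \<in> P")
      case True
      \<comment> \<open>Exclusions are collected by blocks: countably many \<open>x\<close> lie
        below \<open>e\<close>, and each \<open>R\<close>-predecessor \<open>x\<close> of
        \<open>y\<close> lies below \<open>t x\<close>, which is \<open>t y\<close> or comes earlier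
        in \<open>w\<close>.\<close>
      define Bad where "Bad e = (\<Union>x\<in>{x \<in> P. le x e}. {z. \<not> ok f x y z})" for e
      have "countable {x \<in> P. le x e}" for e
      proof (rule countable_subset)
        show "{x \<in> P. le x e} \<subseteq> insert e (if e \<in> U then below e else {})"
          by (auto simp: le_def)
      qed (use below(2) in simp)
      then have Bad: "countable (Bad e)" for e
        unfolding Bad_def using bad[OF _ True] by (intro countable_UN) auto
      obtain z where z: "\<forall>e\<in>insert (t y) (underS w (t y)). z \<notin> Bad e"
        using avoid_countable_sets[where Bad = Bad, OF preds[OF t(1)[OF True]] Bad] by (elim exE)
      have "ok f x y z" if "(x, y) \<in> R" for x
      proof -
        have x: "x \<in> P" "t x \<in> insert (t y) (underS w (t y))"
          using that by (auto simp: R_def underS_def)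
        then have "z \<notin> Bad (t x)" using bspec[OF z] by blast
        then show ?thesis using x(1) t(2)[OF x(1)] by (simp add: Bad_def)
      qed
      then show ?thesis by blast
    qed (simp add: R_def)
  qed
  then obtain f where f: "\<And>x y. (x, y) \<in> R \<Longrightarrow> ok f x y (f y)" by blast

  \<comment> \<open>Verification of the order equivalence\<close>
  show ?thesis
  proof (rule that[of "\<lambda>x. H f x (f x)"], fold le_def P_def)
    fix x y assume xy: "x \<in> P" "y \<in> P"
    show "H f x (f x) \<le>\<^sub>T H f y (f y) \<longleftrightarrow> le x y"
    proof
      assume "le x y"
      then consider "x = y" | "y \<in> U" "x \<in> below y" by (auto simp: le_def)
      then show "H f x (f x) \<le>\<^sub>T H f y (f y)"
      proof cases
        case 2
        then have "x \<notin> U" using below(1) disj by blast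
        then show ?thesis using H_below[OF 2] by (simp add: H_def[of f x])
      qed (simp add: turing_reducible_refl)
    next
      assume red: "H f x (f x) \<le>\<^sub>T H f y (f y)"
      show "le x y"
      proof (rule ccontr)
        assume nle: "\<not> le x y"
        \<comment> \<open>Related pairs were handled by the choice of \<open>f\<close>, so
          \<open>x\<close> and \<open>y\<close> share block and level. Two upper elements of one
          block are equal; two lower ones are separated by independence and the tags
          \<open>h\<close>.\<close>
        then have "(x, y) \<notin> R" "(y, x) \<notin> R" using f[of x y] f[of y x] red unfolding ok_def by blast+
        moreover have "(t x, t y) \<in> w \<or> (t y, t x) \<in> w"
          using w.TOTALS t(1) xy w(2) by blast
        ultimately have "t x = t y" and same: "x \<in> U \<longleftrightarrow> y \<in> U"
          using xy unfolding R_def P_def by auto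
        show False
        proof (cases "x \<in> U")
          case True
          then show False using same t_U \<open>t x = t y\<close> nle by (auto simp: le_def)
        next
          case False
          then have "pack (h x) (f x) = pack (h y) (f y)"
            using red same by (intro p_le) (simp add: H_def)
          then show False using inj_onD[OF h] xy nle by (simp add: le_def)
        qed
      qed
    qed
  qed
qed

text \<open>A real is coded by its lower cut in an enumeration of the rationals.\<close>

lemma real_lepoll_cantor_space: "|UNIV :: real set| \<le>o |UNIV :: (nat \<Rightarrow> bool) set|"
proof -
  have "inj (\<lambda>(x :: real) n. of_rat (from_nat n) < x)"
  proof (rule linorder_injI)
    fix x y :: real assume "x < y"
    then obtain q where "x < of_rat q" "of_rat q < y" using of_rat_dense by blast
    then show "(\<lambda>n. of_rat (from_nat n) < x) \<noteq> (\<lambda>n. of_rat (from_nat n) < y)"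
      by (auto dest: fun_cong[of _ _ "to_nat q"])
  qed
  then show ?thesis unfolding card_of_ordLeq[symmetric] by blast
qed

section \<open>Transfer to degrees and to the given partial order\<close>

lemma degree_le_iff: "degree_le (turing_equiv `` {A}) (turing_equiv `` {B}) \<longleftrightarrow> A \<le>\<^sub>T B"
proof
  assume "degree_le (turing_equiv `` {A}) (turing_equiv `` {B})"
  then obtain A' B' where "A \<le>\<^sub>T A'" "A' \<le>\<^sub>T B'" "B' \<le>\<^sub>T B"
    unfolding degree_le_def turing_equiv_def by blast
  then show "A \<le>\<^sub>T B" using turing_reducible_trans by blast
next
  assume "A \<le>\<^sub>T B"
  moreover have "A \<in> turing_equiv `` {A}" "B \<in> turing_equiv `` {B}"
    by (simp_all add: turing_equiv_def turing_reducible_refl)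
  ultimately show "degree_le (turing_equiv `` {A}) (turing_equiv `` {B})"
    unfolding degree_le_def by blast
qed

theorem theorem1p1:
  fixes P :: "'a set" and r :: "'a rel"
  assumes "partial_order_on P r"
    and "locally_countable P r"
    and "P \<approx> (UNIV :: real set)"
    and "has_height P r 2"
  shows "\<exists>F. (\<forall>x\<in>P. F x \<in> turing_degrees) \<and> inj_on F P \<and>
             (\<forall>x\<in>P. \<forall>y\<in>P. (x, y) \<in> r \<longleftrightarrow> degree_le (F x) (F y))"
proof -
  have refl: "\<And>x. x \<in> P \<Longrightarrow> (x, x) \<in> r" and trans: "trans r" and antisym: "antisym r"
    using partial_order_onD[OF assms(1)] by (auto simp: refl_on_def)
  define below where "below u = {x \<in> P. (x, u) \<in> r \<and> x \<noteq> u}" for u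
  define L where "L = {x \<in> P. below x = {}}"
  define U where "U = {x \<in> P. below x \<noteq> {}}"
  have P: "P = L \<union> U" by (auto simp: L_def U_def)
  have below_L: "below u \<subseteq> L" if "u \<in> U" for u
  proof
    fix x assume x: "x \<in> below u"
    have "below x = {}"
    proof (rule ccontr)
      assume "below x \<noteq> {}"
      then obtain v where v: "v \<in> below x" by blast
      have dist: "v \<noteq> x" "x \<noteq> u" "v \<noteq> u"
        using x v antisymD[OF antisym] by (auto simp: below_def)
      \<comment> \<open>A further element \<open>v\<close> below \<open>x\<close> would give a chain
        of three elements, against height two.\<close>
      have "is_chain P r {v, x, u}"
        using x v that refl transD[OF trans] by (auto simp: is_chain_def below_def U_def)
      then have "card {v, x, u} \<le> 2" using assms(4) unfolding has_height_def by blast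
      then show False using dist by simp
    qed
    then show "x \<in> L" using x by (simp add: L_def below_def)
  qed
  have "|P| \<le>o |UNIV :: (nat \<Rightarrow> bool) set|"
  proof -
    have "|P| \<le>o |UNIV :: real set|"
      using assms(3) unfolding eqpoll_def card_of_ordLeq[symmetric] bij_betw_def by blast
    then show ?thesis using real_lepoll_cantor_space ordLeq_transitive by blast
  qed
  moreover have "L \<inter> U = {}" by (auto simp: L_def U_def)
  moreover have "countable (below u)" if "u \<in> U" for u
    using assms(2) that by (auto simp: locally_countable_def below_def U_def)
  moreover have "below u \<noteq> {}" if "u \<in> U" for u using that by (simp add: U_def)
  ultimately obtain G :: "'a \<Rightarrow> nat set" where G: "\<And>x y. x \<in> P \<Longrightarrow> y \<in> P \<Longrightarrow>
      G x \<le>\<^sub>T G y \<longleftrightarrow> x = y \<or> y \<in> U \<and> x \<in> below y"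
    using below_L two_level_embedding[of L U below] unfolding P by metis
  have G_r: "(x, y) \<in> r \<longleftrightarrow> G x \<le>\<^sub>T G y" if "x \<in> P" "y \<in> P" for x y
    using G[OF that] refl that by (auto simp: below_def U_def)
  define F where "F x = turing_equiv `` {G x}" for x
  have F: "(x, y) \<in> r \<longleftrightarrow> degree_le (F x) (F y)" if "x \<in> P" "y \<in> P" for x y
    using G_r[OF that] by (simp add: F_def degree_le_iff)
  show ?thesis
  proof (intro exI[of _ F] conjI ballI)
    show "F x \<in> turing_degrees" for x
      unfolding F_def turing_degrees_def by (rule quotientI) simp
    \<comment> \<open>Equal degrees are below each other, so antisymmetry of \<open>r\<close>
      identifies the arguments.\<close>
    show "inj_on F P"
      using F refl antisymD[OF antisym] by (intro inj_onI) metis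
  qed (rule F)
qed

end
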